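(* Let $I$ be a compact interval and let $f : I \to I$ be a continuous map. Let $m \ge 5$ be an odd integer and suppose that $f$ has a periodic point of least period $m$. Then for every odd integer $n \ge m$, $f$ has a Štefan cycle of least period $n$. (No assumption is made on the absence of periodic points of $f$ of odd periods smaller than $m$.)
   Context: For $n\ge 1$, $f^n$ denotes the $n$-th iterate of $f$. A point $x_0 \in I$ has least period $n$ if $f^n(x_0)=x_0$ and $f^i(x_0)\ne x_0$ for $0<i<n$. For odd $n\ge 3$, a Štefan cycle of $f$ of least period $n$ is the orbit $\{p,f(p),\dots,f^{n-1}(p)\}$ of a periodic point $p$ of least period $n$ such that either $$f^{n-1}(p)<f^{n-3}(p)<\cdots<f^4(p)<f^2(p)<p<f(p)<f^3(p)<\cdots<f^{n-2}(p),$$ or the mirror image holds: $$f^{n-2}(p)<\cdots<f^3(p)<f(p)<p<f^2(p)<f^4(p)<\cdots<f^{n-1}(p).$$ *)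

theory Defs
  imports "HOL-Analysis.Analysis"
begin

definition least_period_on :: "real set \<Rightarrow> (real \<Rightarrow> real) \<Rightarrow> nat \<Rightarrow> real \<Rightarrow> bool" where
  "least_period_on I f n x \<longleftrightarrow>
     x \<in> I \<and> n \<ge> 1 \<and> (f ^^ n) x = x \<and> (\<forall>i. 0 < i \<and> i < n \<longrightarrow> (f ^^ i) x \<noteq> x)"

text \<open>For odd \<open>n \<ge> 3\<close> the three conjuncts are the consecutive inequalities in the chain
  \<open>f^(n-1) p < f^(n-3) p < \<dots> < f^2 p < p < f p < f^3 p < \<dots> < f^(n-2) p\<close>:
  to the left of \<open>p\<close>, at \<open>p\<close>, and to the right of \<open>f p\<close>.\<close>

definition stefan_order :: "(real \<Rightarrow> real) \<Rightarrow> nat \<Rightarrow> real \<Rightarrow> bool" where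
  "stefan_order f n p \<longleftrightarrow>
     (\<forall>i. even i \<and> i + 2 < n \<longrightarrow> (f ^^ (i + 2)) p < (f ^^ i) p) \<and>
     p < f p \<and>
     (\<forall>i. odd i \<and> i + 2 < n \<longrightarrow> (f ^^ i) p < (f ^^ (i + 2)) p)"

definition stefan_order_mirror :: "(real \<Rightarrow> real) \<Rightarrow> nat \<Rightarrow> real \<Rightarrow> bool" where
  "stefan_order_mirror f n p \<longleftrightarrow>
     (\<forall>i. odd i \<and> i + 2 < n \<longrightarrow> (f ^^ (i + 2)) p < (f ^^ i) p) \<and>
     f p < p \<and>
     (\<forall>i. even i \<and> i + 2 < n \<longrightarrow> (f ^^ i) p < (f ^^ (i + 2)) p)"

definition stefan_cycle :: "real set \<Rightarrow> (real \<Rightarrow> real) \<Rightarrow> nat \<Rightarrow> real set \<Rightarrow> bool" where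
  "stefan_cycle I f n C \<longleftrightarrow>
     odd n \<and> n \<ge> 3 \<and>
     (\<exists>p. least_period_on I f n p \<and> C = (\<lambda>i. (f ^^ i) p) ` {..<n} \<and>
          (stefan_order f n p \<or> stefan_order_mirror f n p))"

end

theory Submission
  imports Defs
begin

text \<open>
  Let \<open>P\<close> be an orbit of odd period \<open>m\<close>, and let \<open>z\<close> be a fixed point between two neighbouring points
  of \<open>P\<close> that \<open>f\<close> maps across \<open>z\<close>. Since \<open>m\<close> is odd, the points of \<open>P\<close> cannot all switch sides of
  \<open>z\<close>: some \<open>d \<in> P\<close> stays on its own side. Up to reflection, \<open>d\<close> can be taken on the left of \<open>z\<close>,
  closest to \<open>z\<close> there, and such that \<open>f\<close> maps a point \<open>x > z\<close> of \<open>P\<close> to \<open>d\<close> or beyond, while all points of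
  \<open>P\<close> between \<open>d\<close> and \<open>x\<close> switch sides (\<open>odd_orbit_imp_stefan\<close>).

  Pull \<open>d\<close> back repeatedly, each time to the preimage on the other side of \<open>z\<close> that is nearest to \<open>z\<close>.
  This gives an infinite sequence \<open>s 0 = d, s 1, s 2, \<dots>\<close> that spirals in towards \<open>z\<close>:
  \<open>s 0 \<le> s 2 \<le> s 4 \<le> \<dots> < z < \<dots> \<le> s 3 \<le> s 1\<close>. Nearness forces \<open>f\<close> to map the points of \<open>P\<close> between
  \<open>s (k + 1)\<close> and \<open>s (k + 2)\<close> to points between \<open>s k\<close> and \<open>s (k + 1)\<close>. Since a periodic orbit has no proper
  nonempty invariant subset, each turn of the spiral excludes at least one more point of \<open>P\<close>, until
  none is left (\<open>card_shrinking_chain\<close>). Thus \<open>f d\<close>, being a point of \<open>P\<close> left of \<open>z\<close>, satisfies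
  \<open>f d \<le> s (n - 1)\<close> for all odd \<open>n \<ge> m\<close> (\<open>stefan_of_left_nonswitching\<close>).

  Consequently the intervals with end points \<open>s (n - 1 - i)\<close> and \<open>s (n + 1 - i)\<close>, for \<open>0 \<le> i < n\<close>, form
  a loop under the covering relation, and a point of period \<open>n\<close> follows it. These intervals
  lie on the line in the order that a Stefan cycle requires, and overlap at most in end points, so
  the orbit of that point is a Stefan cycle of least period \<open>n\<close> (\<open>stefan_from_spiral\<close>).
\<close>

section \<open>Following a loop of intervals\<close>

lemma compact_level_set:
  fixes f :: "real \<Rightarrow> real"
  assumes "continuous_on {l..r} f"
  shows "compact {x \<in> {l..r}. f x = c}"
  unfolding compact_eq_bounded_closed
  using continuous_closed_preimage_constant[OF assms, of c]
  by (auto intro: bounded_subset[OF bounded_closed_interval[of l r]])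

text \<open>Two points mapped to \<open>u\<close> and \<open>v\<close> bound an interval whose image may overshoot. Moving each end
  point inwards, as far as it keeps its value, leaves no point where the image could cross \<open>u\<close> or
  \<open>v\<close> again.\<close>

lemma segment_exact_preimage:
  fixes f :: "real \<Rightarrow> real"
  assumes cont: "continuous_on (closed_segment a b) f"
    and "u \<in> f ` closed_segment a b" "v \<in> f ` closed_segment a b"
  shows "\<exists>p q. p \<in> closed_segment a b \<and> q \<in> closed_segment a b \<and> f p = u \<and> f q = v \<and>
           f ` closed_segment p q \<subseteq> closed_segment u v"
proof -
  have sub: "closed_segment x y \<subseteq> closed_segment a b"
    if "x \<in> closed_segment a b" "y \<in> closed_segment a b" for x y
    using that by (simp add: closed_segment_subset)
  have ordered: "\<exists>p\<in>{c..e}. \<exists>q\<in>{c..e}. f p = u \<and> f q = v \<and> f ` {p..q} \<subseteq> closed_segment u v \<and> p \<le> q"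
    if ce: "c \<le> e" and fc: "f c = u" and fe: "f e = v" and cf: "continuous_on {c..e} f" for c e u v
  proof -
    define V where "V = {x \<in> {c..e}. f x = v}"
    have "compact V"
      unfolding V_def by (rule compact_level_set[OF cf])
    then obtain q where q: "q \<in> V" "\<And>x. x \<in> V \<Longrightarrow> q \<le> x"
      using compact_attains_inf[of V] ce fe unfolding V_def by auto
    have cq: "c \<le> q" "q \<le> e" "f q = v" using q(1) by (auto simp: V_def)
    have cf': "continuous_on {c..q} f" using cf by (rule continuous_on_subset) (use cq in auto)
    define U where "U = {x \<in> {c..q}. f x = u}"
    have "compact U"
      unfolding U_def by (rule compact_level_set[OF cf'])
    then obtain p where p: "p \<in> U" "\<And>x. x \<in> U \<Longrightarrow> x \<le> p"
      using compact_attains_sup[of U] cq fc unfolding U_def by auto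
    have pq: "c \<le> p" "p \<le> q" "f p = u" using p(1) by (auto simp: U_def)
    have "f x \<in> closed_segment u v" if x: "x \<in> {p..q}" for x
    proof (rule ccontr)
      assume no: "f x \<notin> closed_segment u v"
      have c1: "continuous_on (closed_segment x q) f" "continuous_on (closed_segment p x) f"
        by (rule continuous_on_subset[OF cf]; use x pq cq in \<open>auto simp: closed_segment_eq_real_ivl\<close>)+
      have "u \<in> closed_segment (f x) (f q) \<or> v \<in> closed_segment (f p) (f x)"
        using no pq cq by (auto simp: closed_segment_eq_real_ivl split: if_splits)
      then show False
      proof
        assume "u \<in> closed_segment (f x) (f q)"
        then obtain t where t: "t \<in> closed_segment x q" "f t = u"
          using IVT'_closed_segment_real[OF _ c1(1)] by blast
        then have "t \<in> U" using x pq by (auto simp: U_def closed_segment_eq_real_ivl)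
        then have "x = p" using p(2) t x by (force simp: closed_segment_eq_real_ivl)
        then show False using no pq by simp
      next
        assume "v \<in> closed_segment (f p) (f x)"
        then obtain t where t: "t \<in> closed_segment p x" "f t = v"
          using IVT'_closed_segment_real[OF _ c1(2)] by blast
        then have "t \<in> V" using x pq cq by (auto simp: V_def closed_segment_eq_real_ivl)
        then have "x = q" using q(2) t x by (force simp: closed_segment_eq_real_ivl)
        then show False using no cq by simp
      qed
    qed
    then show ?thesis using pq cq by (intro bexI[of _ p] bexI[of _ q]) auto
  qed
  obtain c e where c: "c \<in> closed_segment a b" "f c = u" and e: "e \<in> closed_segment a b" "f e = v"
    using assms(2,3) by auto
  show ?thesis
  proof (cases "c \<le> e")
    case True
    have "{c..e} \<subseteq> closed_segment a b" using sub[OF c(1) e(1)] True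
      by (simp add: closed_segment_eq_real_ivl)
    with ordered[OF True c(2) e(2)] continuous_on_subset[OF cont this] show ?thesis
      by (metis closed_segment_eq_real_ivl subsetD)
  next
    case False
    then have ec: "e \<le> c" by simp
    have "{e..c} \<subseteq> closed_segment a b" using sub[OF e(1) c(1)] ec
      by (simp add: closed_segment_eq_real_ivl)
    with ordered[OF ec e(2) c(2)] continuous_on_subset[OF cont this] show ?thesis
      by (metis closed_segment_eq_real_ivl closed_segment_commute subsetD)
  qed
qed

text \<open>The end points \<open>p\<close> and \<open>q\<close> are needed besides the itinerary: they witness that \<open>f ^^ n\<close> still
  stretches the segment across the last interval, which yields a fixed point of \<open>f ^^ n\<close> for a loop.\<close>

lemma segment_itinerary:
  fixes f :: "real \<Rightarrow> real"
  assumes "\<And>i. i < n \<Longrightarrow> continuous_on (closed_segment (u i) (v i)) f"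
    and "\<And>i. i < n \<Longrightarrow> closed_segment (u (Suc i)) (v (Suc i)) \<subseteq> f ` closed_segment (u i) (v i)"
  shows "\<exists>p q. (\<forall>x\<in>closed_segment p q. \<forall>i\<le>n. (f ^^ i) x \<in> closed_segment (u i) (v i)) \<and>
           (f ^^ n) p = u n \<and> (f ^^ n) q = v n"
  using assms
proof (induction n arbitrary: u v)
  case 0
  show ?case by (intro exI[of _ "u 0"] exI[of _ "v 0"]) simp
next
  case (Suc n)
  obtain p' q' where
    it: "\<forall>x\<in>closed_segment p' q'. \<forall>i\<le>n. (f ^^ i) x \<in> closed_segment (u (Suc i)) (v (Suc i))"
    and ends: "(f ^^ n) p' = u (Suc n)" "(f ^^ n) q' = v (Suc n)"
    using Suc.IH[of "\<lambda>i. u (Suc i)" "\<lambda>i. v (Suc i)"] Suc.prems by (metis Suc_less_eq)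
  have "p' \<in> closed_segment (u 1) (v 1)" "q' \<in> closed_segment (u 1) (v 1)"
    using it by (metis One_nat_def ends_in_segment funpow_0 zero_le)+
  then have "p' \<in> f ` closed_segment (u 0) (v 0)" "q' \<in> f ` closed_segment (u 0) (v 0)"
    using Suc.prems(2)[of 0] by auto
  then obtain p q where pq: "p \<in> closed_segment (u 0) (v 0)" "q \<in> closed_segment (u 0) (v 0)"
    "f p = p'" "f q = q'" "f ` closed_segment p q \<subseteq> closed_segment p' q'"
    using segment_exact_preimage[of "u 0" "v 0" f p' q'] Suc.prems(1)[of 0] by auto
  have sub: "closed_segment p q \<subseteq> closed_segment (u 0) (v 0)"
    using pq(1,2) by (simp add: closed_segment_subset)
  have "(f ^^ i) x \<in> closed_segment (u i) (v i)" if "x \<in> closed_segment p q" "i \<le> Suc n" for x i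
    using that pq(5) sub it by (cases i) (auto simp: funpow_swap1)
  moreover have "(f ^^ Suc n) p = u (Suc n)" "(f ^^ Suc n) q = v (Suc n)"
    using ends pq(3,4) by (simp_all add: funpow_swap1)
  ultimately show ?case by blast
qed

lemma loop_periodic_point:
  fixes f :: "real \<Rightarrow> real"
  assumes cont: "\<And>i. i < n \<Longrightarrow> continuous_on (closed_segment (u i) (v i)) f"
    and cover: "\<And>i. i < n \<Longrightarrow> closed_segment (u (Suc i)) (v (Suc i)) \<subseteq> f ` closed_segment (u i) (v i)"
    and loop: "u n = u 0" "v n = v 0"
  shows "\<exists>y. (f ^^ n) y = y \<and> (\<forall>i\<le>n. (f ^^ i) y \<in> closed_segment (u i) (v i))"
proof -
  obtain p q where it: "\<forall>x\<in>closed_segment p q. \<forall>i\<le>n. (f ^^ i) x \<in> closed_segment (u i) (v i)"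
    and ends: "(f ^^ n) p = u n" "(f ^^ n) q = v n"
    using segment_itinerary[of n u v f, OF cont cover] by blast
  have "continuous_on (closed_segment p q) (f ^^ i)" if "i \<le> n" for i
    using that
  proof (induction i)
    case 0
    then show ?case by (simp add: id_def)
  next
    case (Suc i)
    have "continuous_on ((f ^^ i) ` closed_segment p q) f"
      by (rule continuous_on_subset[OF cont[of i]]) (use Suc.prems it in auto)
    then show ?case using Suc continuous_on_compose[of _ "f ^^ i" f] by simp
  qed
  then have "continuous_on (closed_segment p q) (\<lambda>x. (f ^^ n) x - x)"
    by (intro continuous_intros) auto
  moreover have "p \<in> closed_segment (u n) (v n)" "q \<in> closed_segment (u n) (v n)"
    using it loop by (metis ends_in_segment funpow_0 zero_le)+
  then have "0 \<in> closed_segment ((f ^^ n) p - p) ((f ^^ n) q - q)"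
    using ends by (auto simp: closed_segment_eq_real_ivl split: if_splits)
  ultimately obtain y where "y \<in> closed_segment p q" "(f ^^ n) y - y = 0"
    using IVT'_closed_segment_real[of 0 "\<lambda>x. (f ^^ n) x - x"] by blast
  then show ?thesis using it by (intro exI[of _ y]) auto
qed

section \<open>The inward spiral of preimages\<close>

lemma nearest_preimage_right:
  fixes f :: "real \<Rightarrow> real"
  assumes cont: "continuous_on {z..x} f" and "z \<le> x" "c < f z" "f x \<le> c"
  shows "\<exists>t. z < t \<and> t \<le> x \<and> f t = c \<and> (\<forall>y\<in>{z..<t}. c < f y)"
proof -
  define T where "T = {t \<in> {z..x}. f t = c}"
  have "compact T"
    unfolding T_def by (rule compact_level_set[OF cont])
  moreover have "T \<noteq> {}"
    using IVT2'[of f x c z] assms unfolding T_def by auto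
  ultimately obtain t where t: "t \<in> T" "\<And>y. y \<in> T \<Longrightarrow> t \<le> y"
    using compact_attains_inf by metis
  have t': "z \<le> t" "t \<le> x" "f t = c" using t(1) by (auto simp: T_def)
  have "c < f y" if y: "y \<in> {z..<t}" for y
  proof (rule ccontr)
    assume "\<not> c < f y"
    then obtain w where "w \<in> {z..y}" "f w = c"
      using IVT2'[of f y c z] y t' assms continuous_on_subset[OF cont, of "{z..y}"] by auto
    then have "t \<le> w" using t(2) y t' by (auto simp: T_def)
    with \<open>w \<in> {z..y}\<close> y show False by auto
  qed
  moreover have "t \<noteq> z" using t'(3) assms(3) by auto
  ultimately show ?thesis using t' by (intro exI[of _ t]) auto
qed

lemma nearest_preimage_left:
  fixes f :: "real \<Rightarrow> real"
  assumes cont: "continuous_on {x..z} f" and "x \<le> z" "f z < c" "c \<le> f x"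
  shows "\<exists>t. x \<le> t \<and> t < z \<and> f t = c \<and> (\<forall>y\<in>{t<..z}. f y < c)"
proof -
  have "continuous_on {-z..-x} (\<lambda>y. - f (- y))"
    by (intro continuous_intros continuous_on_compose2[OF cont]) auto
  from nearest_preimage_right[OF this, of "-c"] assms
  obtain t where t: "-z < t" "t \<le> -x" "- f (-t) = -c" "\<forall>y\<in>{-z..<t}. -c < - f (-y)" by auto
  have "f y < c" if "y \<in> {-t<..z}" for y
    using t(4)[rule_format, of "-y"] that by auto
  then show ?thesis using t by (intro exI[of _ "-t"]) auto
qed

text \<open>If \<open>A (k + 1) = A k\<close>, then \<open>A k\<close> is invariant under \<open>f\<close> and therefore empty, since it is a proper subset of
  \<open>P\<close>. So the chain loses an element in every step as long as it is not empty.\<close>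

lemma card_shrinking_chain:
  fixes A :: "nat \<Rightarrow> 'a set"
  assumes "finite P" "A 0 \<subset> P"
    and dec: "\<And>k. A (Suc k) \<subseteq> A k" and maps: "\<And>k. f ` A (Suc k) \<subseteq> A k"
    and irred: "\<And>B. B \<subseteq> P \<Longrightarrow> f ` B \<subseteq> B \<Longrightarrow> B = {} \<or> B = P"
  shows "A k = {} \<or> card (A k) + k < card P"
proof (induction k)
  case 0
  then show ?case using assms(1,2) by (simp add: psubset_card_mono)
next
  case (Suc k)
  have sub: "A k \<subset> P" for k
    using assms(2) by (induction k) (use dec in blast)+
  show ?case
  proof (cases "A (Suc k) = A k")
    case True
    then have "f ` A k \<subseteq> A k" using maps[of k] by simp
    then show ?thesis using irred[of "A k"] sub[of k] True by auto
  next
    case False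
    then have "card (A (Suc k)) < card (A k)"
      using dec[of k] sub[of k] assms(1) finite_subset by (metis psubsetI psubset_card_mono psubset_imp_subset)
    then show ?thesis using Suc by auto
  qed
qed

text \<open>A point that follows the loop visits the rings between consecutive turns of the spiral from the
  inside to the outside, which gives the weak inequalities of a Stefan cycle; the condition on
  \<open>f (s 0)\<close> closes the loop from the outermost ring to the innermost. The inequalities are strict
  because an equality would make \<open>f ^^ 2\<close>, and as \<open>n\<close> is odd also \<open>f\<close>, fix a point of the orbit,
  although successive points lie on different sides of \<open>z\<close>.\<close>

lemma stefan_from_spiral:
  fixes f :: "real \<Rightarrow> real" and s :: "nat \<Rightarrow> real"
  assumes cont: "continuous_on {a..b} f" and n: "odd n" "n \<ge> 3"
    and step: "\<And>k. f (s (Suc k)) = s k"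
    and dom: "\<And>k. s k \<in> {a..b}"
    and left: "\<And>k. even k \<Longrightarrow> s k < z \<and> s k \<le> s (k + 2)"
    and right: "\<And>k. odd k \<Longrightarrow> z < s k \<and> s (k + 2) \<le> s k"
    and turn: "f (s 0) \<le> s (n - 1)"
  shows "\<exists>p. least_period_on {a..b} f n p \<and> stefan_order f n p"
proof -
  \<comment> \<open>The values at \<open>i = n\<close> repeat those at \<open>i = 0\<close>, so that the loop closes.\<close>
  define u where "u i = (if i < n then s (n - 1 - i) else s (n - 1))" for i
  define v where "v i = (if i < n then s (n + 1 - i) else s (n + 1))" for i
  have dom': "closed_segment (s i) (s j) \<subseteq> {a..b}" for i j
    using dom by (auto simp: closed_segment_subset convex_real_interval)
  have img: "closed_segment (f x) (f y) \<subseteq> f ` closed_segment x y"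
    if "closed_segment x y \<subseteq> {a..b}" for x y
    using IVT'_closed_segment_real[OF _ continuous_on_subset[OF cont that]] by blast
  have cover: "closed_segment (u (Suc i)) (v (Suc i)) \<subseteq> f ` closed_segment (u i) (v i)" if "i < n" for i
  proof (cases "Suc i < n")
    case True
    then obtain j where j: "n = Suc (Suc (i + j))" using less_imp_Suc_add[OF True] by auto
    have "n - 1 - i = Suc j" "n + 1 - i = Suc (Suc (Suc j))" "n - 1 - Suc i = j" "n + 1 - Suc i = Suc (Suc j)"
      using j by auto
    then have "u i = s (Suc j)" "v i = s (Suc (Suc (Suc j)))" "u (Suc i) = s j" "v (Suc i) = s (Suc (Suc j))"
      using True by (auto simp: u_def v_def)
    then show ?thesis
      using img[of "u i" "v i"] dom' step by metis
  next
    case False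
    then have i: "i = n - 1" using that by simp
    have e: "even (n - 1)" "n - 1 + 2 = n + 1" "even (n + 1)" using n by auto
    have "f (s 0) \<le> s (n - 1)" "s (n - 1) \<le> s (n + 1)" "s (n + 1) < s 1" "f (s 2) = s 1"
      using turn left[OF e(1)] left[OF e(3)] right[of 1] step[of 1] unfolding e(2)
      by (simp_all add: numeral_2_eq_2)
    then have "closed_segment (s (n - 1)) (s (n + 1)) \<subseteq> closed_segment (f (s 0)) (f (s 2))"
      by (auto simp: closed_segment_eq_real_ivl)
    also have "\<dots> \<subseteq> f ` closed_segment (s 0) (s 2)" by (rule img[OF dom'])
    finally show ?thesis using i n by (simp add: u_def v_def)
  qed
  have "\<exists>y. (f ^^ n) y = y \<and> (\<forall>i\<le>n. (f ^^ i) y \<in> closed_segment (u i) (v i))"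
  proof (rule loop_periodic_point)
    show "closed_segment (u (Suc i)) (v (Suc i)) \<subseteq> f ` closed_segment (u i) (v i)" if "i < n" for i
      by (rule cover[OF that])
    show "continuous_on (closed_segment (u i) (v i)) f" for i
      by (rule continuous_on_subset[OF cont]) (use dom' in \<open>auto simp: u_def v_def\<close>)
  qed (use n in \<open>auto simp: u_def v_def\<close>)
  then obtain p where per: "(f ^^ n) p = p"
    and it: "\<And>i. i \<le> n \<Longrightarrow> (f ^^ i) p \<in> closed_segment (u i) (v i)" by blast
  have L: "s (n - 1 - i) \<le> (f ^^ i) p \<and> (f ^^ i) p \<le> s (n + 1 - i) \<and> (f ^^ i) p < z" if "even i" "i < n" for i
  proof -
    have e: "even (n - 1 - i)" "n + 1 - i = n - 1 - i + 2" using that n by auto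
    then show ?thesis using it[of i] left[of "n - 1 - i"] left[of "n + 1 - i"] that
      by (auto simp: u_def v_def closed_segment_eq_real_ivl)
  qed
  have R: "s (n + 1 - i) \<le> (f ^^ i) p \<and> (f ^^ i) p \<le> s (n - 1 - i) \<and> z < (f ^^ i) p" if "odd i" "i < n" for i
  proof -
    have "odd (n - 1 - i)" using that n by presburger
    moreover have "n + 1 - i = n - 1 - i + 2" using that by simp
    ultimately show ?thesis using it[of i] right[of "n - 1 - i"] right[of "n + 1 - i"] that
      by (auto simp: u_def v_def closed_segment_eq_real_ivl split: if_splits)
  qed
  have ne: "(f ^^ (i + 2)) p \<noteq> (f ^^ i) p" if "i + 1 < n" for i
  proof
    assume "(f ^^ (i + 2)) p = (f ^^ i) p"
    then have two: "(f ^^ 2) ((f ^^ i) p) = (f ^^ i) p" by (simp add: numeral_2_eq_2)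
    have "(f ^^ (2 * j)) ((f ^^ i) p) = (f ^^ i) p" for j
      by (induction j) (use two in \<open>simp_all add: numeral_2_eq_2\<close>)
    moreover obtain j where "n = Suc (2 * j)" using n by (auto elim: oddE)
    ultimately have "(f ^^ n) ((f ^^ i) p) = (f ^^ Suc i) p" by simp
    moreover have "(f ^^ n) ((f ^^ i) p) = (f ^^ i) ((f ^^ n) p)"
      by (metis add.commute comp_apply funpow_add)
    ultimately have "(f ^^ i) p = (f ^^ Suc i) p" using per by simp
    then show False using L[of i] R[of i] L[of "Suc i"] R[of "Suc i"] that by (cases "even i") auto
  qed
  have even_less: "(f ^^ (i + 2)) p < (f ^^ i) p" if "even i" "i + 2 < n" for i
    using L[of i] L[of "i + 2"] ne[of i] that by (simp add: less_le)
  have odd_less: "(f ^^ i) p < (f ^^ (i + 2)) p" if "odd i" "i + 2 < n" for i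
    using R[of i] R[of "i + 2"] ne[of i] that by (simp add: less_le)
  have "p < z" using L[of 0] n by simp
  have "z < f p" using R[of 1] n by simp
  have off: "(f ^^ i) p \<noteq> p" if "0 < i" "i < n" for i
  proof (cases "even i")
    case True
    then obtain j where j: "i = 2 * j" by auto
    have "(f ^^ (2 * Suc k)) p < p" if "2 * Suc k < n" for k
      using that
    proof (induction k)
      case 0 then show ?case using even_less[of 0] by (simp add: numeral_2_eq_2)
    next
      case (Suc k)
      then show ?case using even_less[of "2 * Suc k"] by simp
    qed
    from this[of "j - 1"] show ?thesis using j that by auto
  next
    case False
    then show ?thesis using R[of i] \<open>p < z\<close> that by auto
  qed
  have "p \<in> {a..b}"
    using it[of 0] subsetD[OF dom', of p "n - 1" "n + 1"] n by (simp add: u_def v_def)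
  then have "least_period_on {a..b} f n p"
    unfolding least_period_on_def using n per off by auto
  moreover have "stefan_order f n p"
    unfolding stefan_order_def using even_less odd_less \<open>p < z\<close> \<open>z < f p\<close> by auto
  ultimately show ?thesis by blast
qed

text \<open>The point \<open>x\<close> provides the first preimage \<open>e\<close> of \<open>d\<close> across \<open>z\<close>. The point \<open>q\<close> provides the second
  turn: since the orbit points between \<open>d\<close> and \<open>e\<close> are not an invariant set, one of them on the left is
  mapped to \<open>e\<close> or beyond. From there on the spiral continues by the intermediate value theorem.\<close>

lemma stefan_of_left_nonswitching:
  fixes f :: "real \<Rightarrow> real"
  assumes cont: "continuous_on {a..b} f" and n: "odd n" "n \<ge> 3"
    and P: "finite P" "P \<subseteq> {a..b}" "f ` P \<subseteq> P" "card P \<le> n"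
    and irred: "\<And>B. B \<subseteq> P \<Longrightarrow> f ` B \<subseteq> B \<Longrightarrow> B = {} \<or> B = P"
    and z: "f z = z"
    and d: "d \<in> P" "d < z" "f d < z"
    and x: "x \<in> P" "z < x" "f x \<le> d"
    and q: "q \<in> P" "d < q" "q < z"
    and switch: "\<And>y. y \<in> P \<Longrightarrow> d < y \<Longrightarrow> y \<le> x \<Longrightarrow> (y < z \<and> z < f y) \<or> (z < y \<and> f y < z)"
  shows "\<exists>p. least_period_on {a..b} f n p \<and> stefan_order f n p"
proof -
  have sub: "{c..e} \<subseteq> {a..b}" if "d \<le> c" "e \<le> x" for c e
    using d(1) x(1) P(2) that by fastforce
  obtain e where e: "z < e" "e \<le> x" "f e = d" "\<forall>y\<in>{z..<e}. d < f y"
    using nearest_preimage_right[of z x f d] continuous_on_subset[OF cont sub, of z x] z d x by auto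
  have "\<exists>y\<in>{d..z}. e \<le> f y"
  proof (rule ccontr)
    assume no: "\<not> ?thesis"
    \<comment> \<open>Otherwise the orbit points between \<open>d\<close> and \<open>e\<close> would be an invariant set.\<close>
    define B where "B = P \<inter> {d<..<e}"
    have "f ` B \<subseteq> B"
    proof
      fix w assume "w \<in> f ` B"
      then obtain y where y: "y \<in> P" "d < y" "y < e" "w = f y" by (auto simp: B_def)
      then have "(y < z \<and> z < f y) \<or> (z < y \<and> f y < z)" using switch[of y] e by auto
      moreover have "f y \<in> P" using P(3) y by auto
      moreover have "f y < e" if "y < z" using no y that by (auto simp: not_le)
      moreover have "d < f y" if "z < y" using e(4) y that by auto
      ultimately show "w \<in> B" using y e d by (auto simp: B_def)
    qed
    then have "B = {} \<or> B = P" by (intro irred) (auto simp: B_def)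
    then show False using q d e by (auto simp: B_def)
  qed
  then obtain y0 where y0: "d \<le> y0" "y0 \<le> z" "e \<le> f y0" by auto
  have "\<exists>t. (c < z \<longrightarrow> z < t \<and> t \<le> e \<and> f t = c \<and> (\<forall>y\<in>{z..<t}. c < f y)) \<and>
            (z < c \<longrightarrow> d \<le> t \<and> t < z \<and> f t = c \<and> (\<forall>y\<in>{t<..z}. f y < c))"
    if c: "d \<le> c" "c \<le> e" for c
  proof (cases c z rule: linorder_cases)
    case less
    then show ?thesis
      using nearest_preimage_right[of z e f c] continuous_on_subset[OF cont sub, of z e] z d e c by auto
  next
    case equal
    then show ?thesis by simp
  next
    case greater
    have "continuous_on {y0..z} f"
      by (rule continuous_on_subset[OF cont sub]) (use y0 x in auto)
    then obtain t where "y0 \<le> t" "t < z" "f t = c" "\<forall>y\<in>{t<..z}. f y < c"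
      using nearest_preimage_left[of y0 z f c] z greater c y0 by auto
    then show ?thesis using greater y0 by (intro exI[of _ t]) auto
  qed
  then obtain h where h:
    "\<And>c. d \<le> c \<Longrightarrow> c \<le> e \<Longrightarrow>
           (c < z \<longrightarrow> z < h c \<and> h c \<le> e \<and> f (h c) = c \<and> (\<forall>y\<in>{z..<h c}. c < f y)) \<and>
           (z < c \<longrightarrow> d \<le> h c \<and> h c < z \<and> f (h c) = c \<and> (\<forall>y\<in>{h c<..z}. f y < c))"
    by metis
  have
    hL: "\<And>c. d \<le> c \<Longrightarrow> c < z \<Longrightarrow> z < h c \<and> h c \<le> e \<and> f (h c) = c \<and> (\<forall>y\<in>{z..<h c}. c < f y)" and
    hR: "\<And>c. z < c \<Longrightarrow> c \<le> e \<Longrightarrow> d \<le> h c \<and> h c < z \<and> f (h c) = c \<and> (\<forall>y\<in>{h c<..z}. f y < c)"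
    using h e(1) d(2) by auto
  define s where "s k = (h ^^ k) d" for k
  have s0: "s 0 = d" and sS: "s (Suc k) = h (s k)" for k by (simp_all add: s_def)
  have side: "if even k then d \<le> s k \<and> s k < z else z < s k \<and> s k \<le> e" for k
    by (induction k) (use s0 sS d hL hR in \<open>auto split: if_splits\<close>)
  have step: "f (s (Suc k)) = s k" for k
    using side[of k] hL[of "s k"] hR[of "s k"] by (auto simp: sS split: if_splits)
  have nearR: "s k < f y" if "even k" "z \<le> y" "y < s (Suc k)" for k y
    using side[of k] hL[of "s k"] that by (auto simp: sS)
  have nearL: "f y < s k" if "odd k" "s (Suc k) < y" "y \<le> z" for k y
    using side[of k] hR[of "s k"] that by (auto simp: sS)
  have inward: "if even k then s k \<le> s (k + 2) else s (k + 2) \<le> s k" for k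
  proof (induction k)
    case 0
    then show ?case using side[of 2] by (simp add: s0 numeral_2_eq_2)
  next
    case (Suc k)
    show ?case
    proof (cases "even k")
      case True
      have "s (Suc k + 2) \<le> s (Suc k)"
      proof (rule ccontr)
        assume "\<not> ?thesis"
        then have "s (k + 2) < f (s (Suc k))"
          using nearR[of "k + 2" "s (Suc k)"] side[of "Suc k"] True by auto
        then show False using step Suc True by simp
      qed
      then show ?thesis using True by simp
    next
      case False
      have "s (Suc k) \<le> s (Suc k + 2)"
      proof (rule ccontr)
        assume "\<not> ?thesis"
        then have "f (s (Suc k)) < s (k + 2)"
          using nearL[of "k + 2" "s (Suc k)"] side[of "Suc k"] False by auto
        then show False using step Suc False by simp
      qed
      then show ?thesis using False by simp
    qed
  qed
  \<comment> \<open>The orbit points strictly inside the \<open>k\<close>-th turn of the spiral.\<close>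
  define A where "A k = P \<inter> open_segment (s k) (s (Suc k))" for k
  have A_even: "A k = P \<inter> {s k<..<s (Suc k)}" if "even k" for k
    using side[of k] side[of "Suc k"] that by (auto simp: A_def open_segment_eq_real_ivl)
  have A_odd: "A k = P \<inter> {s (Suc k)<..<s k}" if "odd k" for k
    using side[of k] side[of "Suc k"] that by (auto simp: A_def open_segment_eq_real_ivl)
  have dec: "A (Suc k) \<subseteq> A k" for k
    using inward[of k] by (cases "even k") (auto simp: A_even A_odd)
  have "A 0 \<subset> P" using d s0 by (auto simp: A_even)
  have switchA: "(y < z \<and> z < f y) \<or> (z < y \<and> f y < z)" if "y \<in> A k" for y k
  proof -
    have "y \<in> P" "d < y" "y \<le> x"
      using side[of k] side[of "Suc k"] that e(2)
      by (cases "even k"; auto simp: A_even A_odd)+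
    then show ?thesis by (rule switch)
  qed
  have maps: "f ` A (Suc k) \<subseteq> A k" for k
  proof
    fix w assume "w \<in> f ` A (Suc k)"
    then obtain y where y: "y \<in> A (Suc k)" "w = f y" by auto
    have wP: "w \<in> P" using y P(3) by (auto simp: A_def)
    note sw = switchA[OF y(1)]
    show "w \<in> A k"
    proof (cases "even k")
      case True
      then show ?thesis
        using sw y wP nearR[of k y] nearL[of "Suc k" y] side[of k] side[of "Suc k"]
        by (auto simp: A_even A_odd)
    next
      case False
      then show ?thesis
        using sw y wP nearL[of k y] nearR[of "Suc k" y] side[of k] side[of "Suc k"]
        by (auto simp: A_even A_odd)
    qed
  qed
  have "A (n - 1) = {} \<or> card (A (n - 1)) + (n - 1) < card P"
    using card_shrinking_chain[of P A f, OF P(1) \<open>A 0 \<subset> P\<close> dec maps irred] .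
  moreover have "finite (A (n - 1))" using P(1) by (simp add: A_def)
  ultimately have "A (n - 1) = {}" using P(4) by (cases "card (A (n - 1))") auto
  moreover have "f d \<in> P" "even (n - 1)" using P(3) d n by auto
  ultimately have "f d \<le> s (n - 1)"
    using side[of "Suc (n - 1)"] d by (fastforce simp: A_even)
  show ?thesis
  proof (rule stefan_from_spiral[OF cont n])
    show "f (s (Suc k)) = s k" for k by (rule step)
    show "s k \<in> {a..b}" for k
      using side[of k] sub[of d x] e d x by (auto split: if_splits)
    show "even k \<Longrightarrow> s k < z \<and> s k \<le> s (k + 2)" for k
      using side[of k] inward[of k] by auto
    show "odd k \<Longrightarrow> z < s k \<and> s (k + 2) \<le> s k" for k
      using side[of k] inward[of k] by auto
    show "f (s 0) \<le> s (n - 1)" using \<open>f d \<le> s (n - 1)\<close> s0 by simp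
  qed
qed

text \<open>Conjugating \<open>f\<close> with the reflection in the origin moves the non-switching point to the left, and it
  exchanges the two orders of a Stefan cycle.\<close>

lemma stefan_of_right_nonswitching:
  fixes f :: "real \<Rightarrow> real"
  assumes cont: "continuous_on {a..b} f" and n: "odd n" "n \<ge> 3"
    and P: "finite P" "P \<subseteq> {a..b}" "f ` P \<subseteq> P" "card P \<le> n"
    and irred: "\<And>B. B \<subseteq> P \<Longrightarrow> f ` B \<subseteq> B \<Longrightarrow> B = {} \<or> B = P"
    and z: "f z = z"
    and d: "d \<in> P" "z < d" "z < f d"
    and x: "x \<in> P" "x < z" "d \<le> f x"
    and q: "q \<in> P" "q < d" "z < q"
    and switch: "\<And>y. y \<in> P \<Longrightarrow> y < d \<Longrightarrow> x \<le> y \<Longrightarrow> (y < z \<and> z < f y) \<or> (z < y \<and> f y < z)"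
  shows "\<exists>p. least_period_on {a..b} f n p \<and> stefan_order_mirror f n p"
proof -
  define g where "g y = - f (- y)" for y
  have iter: "(g ^^ i) y = - (f ^^ i) (- y)" for i y
    by (induction i) (simp_all add: g_def)
  have "\<exists>p. least_period_on {-b..-a} g n p \<and> stefan_order g n p"
  proof (rule stefan_of_left_nonswitching[where P = "uminus ` P"
        and z = "-z" and d = "-d" and x = "-x" and q = "-q"])
    show "continuous_on {-b..-a} g"
      unfolding g_def by (intro continuous_intros continuous_on_compose2[OF cont]) auto
    show "card (uminus ` P) \<le> n" using P(1,4) card_image_le le_trans by blast
    show "B = {} \<or> B = uminus ` P" if B: "B \<subseteq> uminus ` P" "g ` B \<subseteq> B" for B
    proof -
      have "uminus ` B \<subseteq> P" using B(1) by auto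
      moreover have "f ` uminus ` B \<subseteq> uminus ` B"
      proof
        fix w assume "w \<in> f ` uminus ` B"
        then obtain y where "y \<in> B" "w = f (- y)" by auto
        then have "- w \<in> B" using B(2) by (auto simp: g_def)
        then show "w \<in> uminus ` B" by force
      qed
      ultimately have "uminus ` B = {} \<or> uminus ` B = P" by (rule irred)
      then show ?thesis by (auto simp: image_image)
    qed
    show "(y < - z \<and> - z < g y) \<or> (- z < y \<and> g y < - z)"
      if "y \<in> uminus ` P" "- d < y" "y \<le> - x" for y
      using that switch[of "-y"] by (auto simp: g_def)
  qed (use n P z d x q in \<open>auto simp: g_def\<close>)
  then obtain p where "least_period_on {-b..-a} g n p" "stefan_order g n p" by blast
  then have "least_period_on {a..b} f n (-p) \<and> stefan_order_mirror f n (-p)"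
    unfolding least_period_on_def stefan_order_def stefan_order_mirror_def iter
    by (auto simp: g_def)
  then show ?thesis by blast
qed

section \<open>Locating the non-switching point\<close>

text \<open>To find the non-switching point, consider the set \<open>G\<close> of those \<open>y \<in> P\<close> for which all points of \<open>P\<close>
  from \<open>z\<close> to \<open>y\<close> switch sides. It is nonempty and not all of \<open>P\<close>, hence some \<open>x \<in> G\<close> is mapped out of
  \<open>G\<close>, and the non-switching point nearest to \<open>z\<close> between \<open>z\<close> and \<open>f x\<close> is the right choice.\<close>

lemma odd_orbit_imp_stefan:
  fixes f :: "real \<Rightarrow> real"
  assumes cont: "continuous_on {a..b} f" and maps: "f ` {a..b} \<subseteq> {a..b}"
    and m: "odd m" "m \<ge> 3" and x0: "least_period_on {a..b} f m x0"
    and n: "odd n" "m \<le> n"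
  shows "\<exists>p. least_period_on {a..b} f n p \<and> (stefan_order f n p \<or> stefan_order_mirror f n p)"
proof -
  have x0': "x0 \<in> {a..b}" "(f ^^ m) x0 = x0" "f x0 \<noteq> x0"
    using x0 m by (auto simp: least_period_on_def dest: spec[of _ 1])
  define P where "P = (\<lambda>i. (f ^^ i) x0) ` {..<m}"
  have orbit: "(f ^^ i) x0 \<in> P" for i
  proof -
    have "(f ^^ i) x0 = (f ^^ (i mod m)) x0" using x0'(2) by (simp add: funpow_mod_eq)
    then show ?thesis using m by (auto simp: P_def)
  qed
  have "x0 \<in> P" using orbit[of 0] by simp
  have P: "finite P" "card P \<le> n" "f ` P \<subseteq> P"
  proof -
    show "card P \<le> n" unfolding P_def using card_image_le[of "{..<m}" "\<lambda>i. (f ^^ i) x0"] n by simp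
    show "f ` P \<subseteq> P"
    proof
      fix y assume "y \<in> f ` P"
      then obtain i where "y = (f ^^ Suc i) x0" by (auto simp: P_def)
      then show "y \<in> P" using orbit by metis
    qed
  qed (simp add: P_def)
  have "(f ^^ i) x0 \<in> {a..b}" for i
  proof (induction i)
    case (Suc i)
    then show ?case using maps by (simp add: image_subset_iff)
  qed (use x0' in simp)
  then have Pab: "P \<subseteq> {a..b}" by (auto simp: P_def)
  have irred: "B = {} \<or> B = P" if B: "B \<subseteq> P" "f ` B \<subseteq> B" for B
  proof (rule disjCI)
    assume "B \<noteq> P"
    show "B = {}"
    proof (rule ccontr)
      assume "B \<noteq> {}"
      then obtain i where i: "i < m" "(f ^^ i) x0 \<in> B" using B by (auto simp: P_def)
      have shift: "(f ^^ (j + i)) x0 \<in> B" for j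
        by (induction j) (use i B in auto)
      have "(f ^^ j) x0 \<in> B" for j
      proof -
        have "(f ^^ (j + m)) x0 \<in> B" using shift[of "j + m - i"] i by simp
        then show ?thesis using x0'(2) by (simp add: funpow_add)
      qed
      then have "P \<subseteq> B" by (auto simp: P_def)
      then show False using \<open>B \<noteq> P\<close> B by auto
    qed
  qed
  have nofix: "f y \<noteq> y" if "y \<in> P" for y
  proof
    assume "f y = y"
    then have "{y} = P" using irred[of "{y}"] that by auto
    then have "x0 = y" using \<open>x0 \<in> P\<close> by auto
    then show False using \<open>f y = y\<close> x0' by simp
  qed
  have fP: "f y \<in> P" if "y \<in> P" for y using P(3) that by auto
  have ne: "P \<noteq> {}" using \<open>x0 \<in> P\<close> by blast
  have "Min P < f (Min P)"
    using nofix[OF Min_in[OF P(1) ne]] Min_le[OF P(1) fP[OF Min_in[OF P(1) ne]]] by simp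
  then have up: "{y \<in> P. y < f y} \<noteq> {}" using Min_in[OF P(1) ne] by blast
  \<comment> \<open>Between \<open>q\<close>, the last orbit point that moves right, and its right neighbour \<open>q'\<close> lies \<open>z\<close>.\<close>
  define q where "q = Max {y \<in> P. y < f y}"
  have q: "q \<in> P" "q < f q"
    using Max_in[OF _ up] P(1) unfolding q_def by auto
  have qmax: "y \<le> q" if "y \<in> P" "y < f y" for y
    using P(1) that unfolding q_def by auto
  have above: "{y \<in> P. q < y} \<noteq> {}" using q fP by blast
  define q' where "q' = Min {y \<in> P. q < y}"
  have q': "q' \<in> P" "q < q'"
    using Min_in[OF _ above] P(1) unfolding q'_def by auto
  have adjacent: "y \<le> q \<or> q' \<le> y" if "y \<in> P" for y
    using P(1) that unfolding q'_def by (cases "q < y") auto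
  have fq: "q' \<le> f q" using adjacent[OF fP[OF q(1)]] q(2) by simp
  have "f q' < q'" using qmax[OF q'(1)] nofix[OF q'(1)] q'(2) by linarith
  then have fq': "f q' \<le> q" using adjacent[OF fP[OF q'(1)]] by simp
  have "continuous_on {q..q'} (\<lambda>x. f x - x)"
    by (intro continuous_intros continuous_on_subset[OF cont]) (use Pab q q' in force)
  then obtain z where z: "q \<le> z" "z \<le> q'" "f z = z"
    using IVT2'[of "\<lambda>x. f x - x" q' 0 q] fq fq' q' by fastforce
  have offP: "y \<noteq> z" if "y \<in> P" for y using nofix[OF that] z(3) by auto
  have qz: "q < z" "z < q'" using z offP[OF q(1)] offP[OF q'(1)] by auto
  define sw where "sw y \<longleftrightarrow> (y < z \<and> z < f y) \<or> (z < y \<and> f y < z)" for y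
  have "\<not> (\<forall>y\<in>P. sw y)"
  proof
    assume all: "\<forall>y\<in>P. sw y"
    have "((f ^^ i) x0 < z \<longleftrightarrow> x0 < z) \<longleftrightarrow> even i" for i
    proof (induction i)
      case (Suc i)
      then show ?case using all[rule_format, OF orbit[of i]] by (auto simp: sw_def)
    qed simp
    \<comment> \<open>After an odd number of switches the orbit would close up on the wrong side.\<close>
    from this[of m] show False using x0'(2) m by simp
  qed
  then obtain w where w: "w \<in> P" "\<not> sw w" by blast
  define G where "G = {y \<in> P. \<forall>v\<in>P \<inter> closed_segment z y. sw v}"
  have "v = q" if "v \<in> P" "v \<in> closed_segment z q" for v
    using adjacent[OF that(1)] that(2) qz by (auto simp: closed_segment_eq_real_ivl)
  moreover have "sw q" using qz fq by (simp add: sw_def)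
  ultimately have "q \<in> G" using q by (auto simp: G_def)
  moreover have "G \<noteq> P" using w by (auto simp: G_def)
  ultimately have "\<not> f ` G \<subseteq> G" using irred[of G] by (auto simp: G_def)
  then obtain x where x: "x \<in> G" "f x \<notin> G" by blast
  have xP: "x \<in> P" "sw x" and xG: "\<And>v. v \<in> P \<Longrightarrow> v \<in> closed_segment z x \<Longrightarrow> sw v"
    using x(1) by (auto simp: G_def)
  define N where "N = {v \<in> P \<inter> closed_segment z (f x). \<not> sw v}"
  have N: "finite N" "N \<noteq> {}" using x(2) fP[OF xP(1)] P(1) by (auto simp: N_def G_def)
  have n3: "n \<ge> 3" using m n by simp
  show ?thesis
  proof (cases "z < x")
    case True
    then have fx: "f x < z" using xP by (auto simp: sw_def)
    define d where "d = Max N"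
    have "d \<in> N" unfolding d_def by (rule Max_in[OF N])
    then have d: "d \<in> P" "f x \<le> d" "d < z" "\<not> sw d"
      using fx offP[of d] by (auto simp: N_def closed_segment_eq_real_ivl)
    have "f d < z" using d offP[OF fP[OF d(1)]] by (auto simp: sw_def)
    have "d \<noteq> q" using d(4) qz fq by (auto simp: sw_def)
    then have "d < q" using adjacent[OF d(1)] d qz by auto
    have "(y < z \<and> z < f y) \<or> (z < y \<and> f y < z)" if y: "y \<in> P" "d < y" "y \<le> x" for y
    proof (cases "y < z")
      case True
      have "sw y"
      proof (rule ccontr)
        assume "\<not> sw y"
        then have "y \<in> N" using y d True by (auto simp: N_def closed_segment_eq_real_ivl)
        then show False using y(2) N(1) unfolding d_def by (simp add: leD)
      qed
      then show ?thesis by (simp add: sw_def)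
    next
      case False
      then show ?thesis using xG[OF y(1)] y True unfolding sw_def by (auto simp: closed_segment_eq_real_ivl)
    qed
    from stefan_of_left_nonswitching[OF cont n(1) n3 P(1) Pab P(3,2)
        irred z(3) d(1,3) \<open>f d < z\<close> xP(1) True
        d(2) q(1) \<open>d < q\<close> qz(1) this]
    show ?thesis by blast
  next
    case False
    then have xz: "x < z" using offP[OF xP(1)] by simp
    then have fx: "z < f x" using xP by (auto simp: sw_def)
    define d where "d = Min N"
    have "d \<in> N" unfolding d_def by (rule Min_in[OF N])
    then have d: "d \<in> P" "d \<le> f x" "z < d" "\<not> sw d"
      using fx offP[of d] by (auto simp: N_def closed_segment_eq_real_ivl)
    have "z < f d" using d offP[OF fP[OF d(1)]] by (auto simp: sw_def)
    have "d \<noteq> q'" using d(4) qz fq' by (auto simp: sw_def)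
    then have "q' < d" using adjacent[OF d(1)] d qz by auto
    have "(y < z \<and> z < f y) \<or> (z < y \<and> f y < z)" if y: "y \<in> P" "y < d" "x \<le> y" for y
    proof (cases "z < y")
      case True
      have "sw y"
      proof (rule ccontr)
        assume "\<not> sw y"
        then have "y \<in> N" using y d True by (auto simp: N_def closed_segment_eq_real_ivl)
        then show False using y(2) N(1) unfolding d_def by (simp add: leD)
      qed
      then show ?thesis by (simp add: sw_def)
    next
      case False
      then show ?thesis using xG[OF y(1)] y xz unfolding sw_def by (auto simp: closed_segment_eq_real_ivl)
    qed
    from stefan_of_right_nonswitching[OF cont n(1) n3 P(1) Pab P(3,2)
        irred z(3) d(1,3) \<open>z < f d\<close> xP(1) xz
        d(2) q'(1) \<open>q' < d\<close> qz(2) this]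
    show ?thesis by blast
  qed
qed

theorem mainTheorem1:
  fixes a b :: real and f :: "real \<Rightarrow> real" and m :: nat
  assumes "a \<le> b"
    and "continuous_on {a..b} f"
    and "f ` {a..b} \<subseteq> {a..b}"
    and "odd m" and "m \<ge> 5"
    and "\<exists>x. least_period_on {a..b} f m x"
  shows "\<forall>n. odd n \<and> n \<ge> m \<longrightarrow> (\<exists>C. stefan_cycle {a..b} f n C)"
proof (intro allI impI)
  fix n assume n: "odd n \<and> n \<ge> m"
  obtain x where "least_period_on {a..b} f m x" using assms(6) by blast
  then obtain p where "least_period_on {a..b} f n p" "stefan_order f n p \<or> stefan_order_mirror f n p"
    using odd_orbit_imp_stefan[OF assms(2,3,4) _ _ _ , of x n] assms(5) n by auto
  then show "\<exists>C. stefan_cycle {a..b} f n C"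
    unfolding stefan_cycle_def using n assms(5) by auto
qed

end
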